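(* (i) If $u:\mathbb{H}\to\mathbb{R}$ is an H-convex function, then the set-valued map $T=\partial_Hu:\mathbb{H}\rightrightarrows V_1$ is maximal H-monotone; moreover it is H-cyclically monotone and hence also maximal H-cyclically monotone. (ii) If $T:\mathbb{H}\rightrightarrows V_1$ is maximal H-cyclically monotone with $\mathrm{dom}(T)=\mathbb{H}$, then there exists an H-convex function $u:\mathbb{H}\to\mathbb{R}$ such that $T=\partial_Hu$.
   Context: The Heisenberg group $\mathbb{H}$ is $\mathbb{R}^3$ with the group law $(x,y,t)\circ(x',y',t')=(x+x',\,y+y',\,t+t'+2(x'y-xy'))$ and unit $e=(0,0,0)$. The first layer $V_1$ of its Lie algebra, spanned by the left-invariant vector fields $X=\partial_x+2y\partial_t$ and $Y=\partial_y-2x\partial_t$, is identified with $\mathbb{R}^2$ (basis $X,Y$) with the Euclidean inner product $\langle\cdot,\cdot\rangle$; for $w=(w_1,w_2)\in V_1$, $\exp w=(w_1,w_2,0)\in\mathbb{H}$. The map $\xi_1:\mathbb{H}\to V_1$ is $\xi_1(x,y,t)=(x,y)$. The horizontal plane through $g_0=(x_0,y_0,t_0)$ is $H_{g_0}=\{g_0\circ\exp w:\ w\in V_1\}=\{(x,y,t):\ t=t_0+2y_0x-2x_0y\}$; one has $g'\in H_g$ iff $g\in H_{g'}$. A function $u:\mathbb{H}\to\mathbb{R}$ is H-convex if $u(g\circ\exp(\lambda v))\le u(g)+\lambda\,(u(g\circ\exp v)-u(g))$ for every $g\in\mathbb{H}$, $v\in V_1$, $\lambda\in[0,1]$. Its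 H-subdifferential at $g$ is $\partial_Hu(g)=\{v\in V_1:\ u(g\circ\exp w)\ge u(g)+\langle v,w\rangle\ \ \forall w\in V_1\}$, and $\partial_Hu:\mathbb{H}\rightrightarrows V_1$ is the set-valued map $g\mapsto\partial_Hu(g)$. For a set-valued map $T:\mathbb{H}\rightrightarrows V_1$ (each $T(g)$ is a possibly empty subset of $V_1$), $\mathrm{dom}(T)=\{g\in\mathbb{H}: T(g)\neq\emptyset\}$ and $\mathrm{gph}(T)=\{(g,v): g\in\mathrm{dom}(T),\ v\in T(g)\}$. $T$ is H-monotone if $\langle v'-v,\xi_1(g')-\xi_1(g)\rangle\ge 0$ for every $g\in\mathrm{dom}(T)$, $g'\in\mathrm{dom}(T)\cap H_g$, $v\in T(g)$, $v'\in T(g')$. A finite sequence $\{g_i\}_{i=0}^n\subset\mathbb{H}$, $n>0$, is a closed H-sequence if $g_{i+1}\in H_{g_i}$ for $i=0,\dots,n-1$ and $g_n\in H_{g_0}$; in this case one sets $g_{n+1}=g_0$. $T$ is H-cyclically monotone if for every sequence $\{(g_i,v_i)\}_{i=0}^n\subset\mathrm{gph}(T)$ such that $\{g_i\}_{i=0}^n$ is a closed H-sequence, $\sum_{i=0}^n\langle\xi_1(g_{i+1}),v_i\rangle\le\sum_{i=0}^n\langle\xi_1(g_i),v_i\rangle$. An H-monotone (resp. H-cyclically monotone) map $T$ is maximal H-monotone (resp. maximal H-cyclically monotone) if there is no H-monotone (resp. H-cyclically monotone) map $T':\mathbb{H}\rightrightarrows V_1$ with $T(g)\subset T'(g)$ for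 all $g\in\mathbb{H}$ and $T(g')\subsetneq T'(g')$ for some $g'\in\mathbb{H}$. *)

theory Defs
  imports "HOL-Analysis.Analysis"
begin

text \<open>Only the carrier set \<open>\<real>\<^sup>3\<close> is taken from the product type; the group law is
  \<open>heis_mult\<close>, not the componentwise addition of the library.\<close>
type_synonym heis = "real \<times> real \<times> real"

text \<open>\<open>(w1, w2)\<close> stands for \<open>w1 X + w2 Y\<close>; the library inner product \<open>\<bullet>\<close> on
  \<open>real \<times> real\<close> is the Euclidean one.\<close>
type_synonym V1 = "real \<times> real"

fun heis_mult :: "heis \<Rightarrow> heis \<Rightarrow> heis" (infixl "\<odot>" 70) where
  "(x, y, t) \<odot> (x', y', t') = (x + x', y + y', t + t' + 2 * (x' * y - x * y'))"

fun hexp :: "V1 \<Rightarrow> heis" where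
  "hexp (w1, w2) = (w1, w2, 0)"

fun \<xi>1 :: "heis \<Rightarrow> V1" where
  "\<xi>1 (x, y, t) = (x, y)"

definition hplane :: "heis \<Rightarrow> heis set" where
  "hplane g0 = {g0 \<odot> hexp w | w. w \<in> UNIV}"

definition H_convex :: "(heis \<Rightarrow> real) \<Rightarrow> bool" where
  "H_convex u \<longleftrightarrow>
     (\<forall>g v. \<forall>l\<in>{0..1}. u (g \<odot> hexp (l *\<^sub>R v)) \<le> u g + l * (u (g \<odot> hexp v) - u g))"

definition H_subdiff :: "(heis \<Rightarrow> real) \<Rightarrow> heis \<Rightarrow> V1 set" where
  "H_subdiff u g = {v. \<forall>w. u (g \<odot> hexp w) \<ge> u g + v \<bullet> w}"

definition sv_dom :: "(heis \<Rightarrow> V1 set) \<Rightarrow> heis set" where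
  "sv_dom T = {g. T g \<noteq> {}}"

definition sv_gph :: "(heis \<Rightarrow> V1 set) \<Rightarrow> (heis \<times> V1) set" where
  "sv_gph T = {(g, v). g \<in> sv_dom T \<and> v \<in> T g}"

definition H_monotone :: "(heis \<Rightarrow> V1 set) \<Rightarrow> bool" where
  "H_monotone T \<longleftrightarrow>
     (\<forall>g\<in>sv_dom T. \<forall>g'\<in>sv_dom T \<inter> hplane g. \<forall>v\<in>T g. \<forall>v'\<in>T g'.
        (v' - v) \<bullet> (\<xi>1 g' - \<xi>1 g) \<ge> 0)"

text \<open>A finite sequence \<open>g\<^sub>0, \<dots>, g\<^sub>n\<close> is represented by a function on \<open>nat\<close>
  of which only the values at \<open>0, \<dots>, n\<close> matter.\<close>
definition closed_H_seq :: "nat \<Rightarrow> (nat \<Rightarrow> heis) \<Rightarrow> bool" where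
  "closed_H_seq n g \<longleftrightarrow>
     n > 0 \<and> (\<forall>i<n. g (Suc i) \<in> hplane (g i)) \<and> g n \<in> hplane (g 0)"

text \<open>The argument \<open>if i = n then g 0 else g (Suc i)\<close> implements the convention
  \<open>g\<^sub>n\<^sub>+\<^sub>1 = g\<^sub>0\<close>.\<close>
definition H_cyclically_monotone :: "(heis \<Rightarrow> V1 set) \<Rightarrow> bool" where
  "H_cyclically_monotone T \<longleftrightarrow>
     (\<forall>n g v. (\<forall>i\<le>n. (g i, v i) \<in> sv_gph T) \<longrightarrow> closed_H_seq n g \<longrightarrow>
        (\<Sum>i=0..n. \<xi>1 (if i = n then g 0 else g (Suc i)) \<bullet> v i)
          \<le> (\<Sum>i=0..n. \<xi>1 (g i) \<bullet> v i))"

definition maximal_H_monotone :: "(heis \<Rightarrow> V1 set) \<Rightarrow> bool" where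
  "maximal_H_monotone T \<longleftrightarrow> H_monotone T \<and>
     \<not> (\<exists>T'. H_monotone T' \<and> (\<forall>g. T g \<subseteq> T' g) \<and> (\<exists>g'. T g' \<subset> T' g'))"

definition maximal_H_cyclically_monotone :: "(heis \<Rightarrow> V1 set) \<Rightarrow> bool" where
  "maximal_H_cyclically_monotone T \<longleftrightarrow> H_cyclically_monotone T \<and>
     \<not> (\<exists>T'. H_cyclically_monotone T' \<and> (\<forall>g. T g \<subseteq> T' g) \<and> (\<exists>g'. T g' \<subset> T' g'))"

lemma hplane_eq:
  "hplane (x0, y0, t0) = {(x, y, t). t = t0 + 2 * y0 * x - 2 * x0 * y}" (is "?L = ?R")
proof
  show "?L \<subseteq> ?R"
    by (auto simp: hplane_def algebra_simps)
  show "?R \<subseteq> ?L"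
  proof clarify
    fix x y t :: real
    have "(x0, y0, t0) \<odot> hexp (x - x0, y - y0) = (x, y, t0 + 2 * y0 * x - 2 * x0 * y)"
      by (simp add: algebra_simps)
    then show "(x, y, t0 + 2 * y0 * x - 2 * x0 * y) \<in> hplane (x0, y0, t0)"
      unfolding hplane_def by (metis (mono_tags, lifting) UNIV_I mem_Collect_eq)
  qed
qed

lemma hplane_sym: "g' \<in> hplane g \<longleftrightarrow> g \<in> hplane g'"
  by (cases g; cases g') (auto simp: hplane_eq algebra_simps)

end

theory Submission
  imports Defs
begin

text \<open>An H-convex function on the Heisenberg group is continuous: it is bounded above on boxes because it is
  bounded above on vertical segments, and convexity along horizontal lines turns an upper bound
  into continuity. Its H-subdifferential is nonempty at the unit: otherwise \<open>0\<close> lies in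
  the convex hull of the strict epigraph of \<open>w \<mapsto> u (exp w) - u e\<close>, so there are
  weights \<open>c\<^sub>i \<ge> 0\<close> with \<open>\<Sum>c\<^sub>i w\<^sub>i = 0\<close> and \<open>\<Sum>c\<^sub>i (u (exp w\<^sub>i) - u e) < 0\<close>. The path with steps \<open>exp (s c\<^sub>i w\<^sub>i)\<close> taken forwards and then in reverse order returns
  exactly to \<open>e\<close>, because reversing the order negates the vertical component; yet for small \<open>s\<close>
  the function \<open>u\<close> strictly decreases along it. Left translation gives nonemptiness everywhere,
  and maximality follows by moving along horizontal lines. Conversely, a cyclically monotone map
  with full domain is contained in \<open>\<partial>\<^sub>H u\<close> for Rockafellar's potential \<open>u\<close>, a supremum
  over horizontal chains.\<close>

section \<open>Group law and horizontal exponentials\<close>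

lemma heis_mult_assoc: "(a \<odot> b) \<odot> c = a \<odot> (b \<odot> c)"
  by (cases a; cases b; cases c) (simp add: algebra_simps)

lemma heis_mult_0_right [simp]: "g \<odot> 0 = g"
  by (cases g) (simp add: zero_prod_def)

lemma heis_mult_0_left [simp]: "0 \<odot> g = g"
  by (cases g) (simp add: zero_prod_def)

lemma hexp_0 [simp]: "hexp 0 = 0"
  by (simp add: zero_prod_def)

text \<open>The group inverse happens to be componentwise negation, so the library \<open>-\<close>
  and \<open>0\<close> serve as inverse and unit.\<close>

lemma heis_mult_uminus_cancel: "a \<odot> ((- a) \<odot> b) = b"
  by (cases a; cases b) (simp add: algebra_simps)

lemma hexp_mult_collinear: "hexp (s *\<^sub>R v) \<odot> hexp (r *\<^sub>R v) = hexp ((s + r) *\<^sub>R v)"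
  by (cases v) (simp add: algebra_simps)

lemma xi1_mult_hexp [simp]: "\<xi>1 (g \<odot> hexp w) = \<xi>1 g + w"
  by (cases g; cases w) simp

lemma mem_hplane_iff: "g' \<in> hplane g \<longleftrightarrow> (\<exists>w. g' = g \<odot> hexp w)"
  by (auto simp: hplane_def)

lemma mult_hexp_mem_hplane: "g \<odot> hexp w \<in> hplane g"
  unfolding mem_hplane_iff by blast

lemma H_subdiffI: "(\<And>w. u g + v \<bullet> w \<le> u (g \<odot> hexp w)) \<Longrightarrow> v \<in> H_subdiff u g"
  unfolding H_subdiff_def by blast

lemma H_subdiffD: "v \<in> H_subdiff u g \<Longrightarrow> u g + v \<bullet> w \<le> u (g \<odot> hexp w)"
  unfolding H_subdiff_def by blast

text \<open>The last four factors form the commutator of \<open>hexp (d, 0)\<close> and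
  \<open>hexp (0, b)\<close>, which is vertical of height \<open>- 4 * d * b\<close>; the choice
  \<open>b = - t / (4 * d)\<close> makes this height \<open>t\<close>.\<close>

lemma heis_word_decomposition:
  assumes "d \<noteq> 0"
  shows "(x, y, t) = hexp (x, y) \<odot> hexp (d, 0) \<odot> hexp (0, - t / (4 * d))
    \<odot> hexp (- d, 0) \<odot> hexp (0, t / (4 * d))"
  using assms by (simp add: field_simps)

section \<open>Continuity of H-convex functions\<close>

lemma H_convexD:
  assumes "H_convex u" "0 \<le> l" "l \<le> 1"
  shows "u (g \<odot> hexp (l *\<^sub>R v)) \<le> u g + l * (u (g \<odot> hexp v) - u g)"
  using assms unfolding H_convex_def by (meson atLeastAtMost_iff)

lemma H_convex_translate:
  assumes "H_convex u"
  shows "H_convex (\<lambda>g. u (h \<odot> g))"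
  using assms unfolding H_convex_def heis_mult_assoc[symmetric] by blast

text \<open>Convexity seen from the middle point \<open>g\<close> of a horizontal segment, with the
  denominator \<open>a + b\<close> cleared. The proof moves the base point to the endpoint
  \<open>p\<close>, where \<open>H_convexD\<close> applies.\<close>

lemma H_convex_between:
  assumes u: "H_convex u" and ab: "0 \<le> a" "0 \<le> b" "0 < a + b"
  shows "(a + b) * u g \<le> a * u (g \<odot> hexp (- b *\<^sub>R v)) + b * u (g \<odot> hexp (a *\<^sub>R v))"
proof -
  define p where "p = g \<odot> hexp (- b *\<^sub>R v)"
  define l where "l = b / (a + b)"
  have l: "0 \<le> l" "l \<le> 1" "l * (a + b) = b"
    using ab by (auto simp: l_def)
  have "p \<odot> hexp (l *\<^sub>R (a + b) *\<^sub>R v) = g"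
    using hexp_mult_collinear[of "- b" v b] l by (simp add: p_def heis_mult_assoc)
  moreover have "p \<odot> hexp ((a + b) *\<^sub>R v) = g \<odot> hexp (a *\<^sub>R v)"
    using hexp_mult_collinear[of "- b" v "a + b"] by (simp add: p_def heis_mult_assoc)
  ultimately have "u g \<le> u p + l * (u (g \<odot> hexp (a *\<^sub>R v)) - u p)"
    using H_convexD[OF u l(1,2), of p "(a + b) *\<^sub>R v"] by simp
  then have "(a + b) * u g \<le> (a + b) * (u p + l * (u (g \<odot> hexp (a *\<^sub>R v)) - u p))"
    using ab by (intro mult_left_mono) auto
  also have "\<dots> = (a + b) * u p + (l * (a + b)) * (u (g \<odot> hexp (a *\<^sub>R v)) - u p)"
    by (simp add: algebra_simps)
  also have "\<dots> = a * u p + b * u (g \<odot> hexp (a *\<^sub>R v))"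
    unfolding l(3) by (simp add: algebra_simps)
  finally show ?thesis
    by (simp add: p_def)
qed

lemma H_convex_le:
  assumes "H_convex u" "0 \<le> a" "0 \<le> b" "0 < a + b"
    and "u (g \<odot> hexp (- b *\<^sub>R v)) \<le> K" "u (g \<odot> hexp (a *\<^sub>R v)) \<le> K"
  shows "u g \<le> K"
proof -
  have "(a + b) * u g \<le> a * u (g \<odot> hexp (- b *\<^sub>R v)) + b * u (g \<odot> hexp (a *\<^sub>R v))"
    using assms(1-4) by (rule H_convex_between)
  also have "\<dots> \<le> a * K + b * K"
    using assms by (intro add_mono mult_left_mono) auto
  finally show ?thesis
    using assms(4) by (simp flip: distrib_right)
qed

text \<open>The endpoints of the horizontal segments in direction \<open>(t / 2, 1)\<close> centred at
  \<open>(x, y, t)\<close> run, as \<open>t\<close> varies, through two horizontal lines.\<close>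

lemma H_convex_bounded_above_vertical:
  assumes u: "H_convex u"
  shows "\<exists>K. \<forall>t. \<bar>t\<bar> \<le> M \<longrightarrow> u (x, y, t) \<le> K"
proof (cases "M > 0")
  case False
  then have "t = 0" if "\<bar>t\<bar> \<le> M" for t
    using that by simp
  then show ?thesis by blast
next
  case True
  \<comment> \<open>For \<sigma> = 1 and \<sigma> = -1 these are the endpoints
    \<open>(x, y, t) \<odot> hexp (\<sigma> *\<^sub>R (t / 2, 1))\<close>.\<close>
  define p where "p \<sigma> t = (x + \<sigma> * (t / 2), y + \<sigma>, t + \<sigma> * (t * y - 2 * x))" for \<sigma> t :: real
  \<comment> \<open>The vertical coordinate grows by a term 2 s \<sigma> \<sigma>, which must equal
    2 s; hence the assumption on \<sigma>.\<close>
  have line: "p \<sigma> t \<odot> hexp (s *\<^sub>R (\<sigma>, 0)) = p \<sigma> (t + 2 * s)" if "\<sigma> * \<sigma> = 1" for \<sigma> t s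
  proof -
    have "\<sigma> * (\<sigma> * z) = z" for z
      using that by (simp flip: mult.assoc)
    then show ?thesis
      by (simp add: p_def algebra_simps)
  qed
  define K where "K = Max {u (p 1 M), u (p 1 (- M)), u (p (-1) M), u (p (-1) (- M))}"
  have "u (p \<sigma> t) \<le> K" if "\<sigma> = 1 \<or> \<sigma> = -1" "\<bar>t\<bar> \<le> M" for \<sigma> t
  proof (rule H_convex_le[OF u, where a = "(M - t) / 2" and b = "(M + t) / 2" and v = "(\<sigma>, 0)"])
    have \<sigma>: "\<sigma> * \<sigma> = 1"
      using that by auto
    have "p \<sigma> t \<odot> hexp (- ((M + t) / 2) *\<^sub>R (\<sigma>, 0)) = p \<sigma> (- M)"
      "p \<sigma> t \<odot> hexp (((M - t) / 2) *\<^sub>R (\<sigma>, 0)) = p \<sigma> M"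
      unfolding line[OF \<sigma>] by (rule arg_cong[where f = "p \<sigma>"], simp add: field_simps)+
    then show "u (p \<sigma> t \<odot> hexp (- ((M + t) / 2) *\<^sub>R (\<sigma>, 0))) \<le> K"
      "u (p \<sigma> t \<odot> hexp (((M - t) / 2) *\<^sub>R (\<sigma>, 0))) \<le> K"
      using that by (auto simp: K_def)
  qed (use that True in \<open>auto simp: field_simps\<close>)
  then have "u (x, y, t) \<le> K" if "\<bar>t\<bar> \<le> M" for t
    using that H_convex_le[OF u, of 1 1 "(x, y, t)" "(t / 2, 1)" K]
    by (force simp: p_def algebra_simps)
  then show ?thesis by blast
qed

lemma abs_mult_le: "\<bar>a\<bar> \<le> A \<Longrightarrow> \<bar>b\<bar> \<le> B \<Longrightarrow> \<bar>a * b\<bar> \<le> A * B"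
  for a b A B :: real
  by (simp add: abs_mult mult_mono)

text \<open>The box is filled by segments in direction X ending on vertical segments, then by
  segments in direction Y ending on the two faces already bounded. Such a segment tilts vertically
  by at most 4 R |y|, respectively 4 R R, which is the extra height allowed for its
  endpoints.\<close>

lemma H_convex_bounded_above_box:
  assumes u: "H_convex u" and R: "R > 0"
  shows "\<exists>K. \<forall>x y t. \<bar>x\<bar> \<le> R \<longrightarrow> \<bar>y\<bar> \<le> R \<longrightarrow> \<bar>t\<bar> \<le> R \<longrightarrow> u (x, y, t) \<le> K"
proof -
  have edge: "\<exists>K. \<forall>x t. \<bar>x\<bar> \<le> R \<longrightarrow> \<bar>t\<bar> \<le> M \<longrightarrow> u (x, y, t) \<le> K" for y M
  proof -
    obtain K1 K2 where
      K1: "\<And>t. \<bar>t\<bar> \<le> M + 4 * (R * \<bar>y\<bar>) \<Longrightarrow> u (R, y, t) \<le> K1" and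
      K2: "\<And>t. \<bar>t\<bar> \<le> M + 4 * (R * \<bar>y\<bar>) \<Longrightarrow> u (- R, y, t) \<le> K2"
      using H_convex_bounded_above_vertical[OF u] by meson
    have "u (x, y, t) \<le> max K1 K2" if xt: "\<bar>x\<bar> \<le> R" "\<bar>t\<bar> \<le> M" for x t
    proof (rule H_convex_le[OF u, where a = "R - x" and b = "R + x" and v = "(1, 0)"])
      have "\<bar>(R - x) * y\<bar> \<le> 2 * R * \<bar>y\<bar>" "\<bar>(R + x) * y\<bar> \<le> 2 * R * \<bar>y\<bar>"
        using xt by (intro abs_mult_le; linarith)+
      then have "u (R, y, t + 2 * ((R - x) * y)) \<le> K1" "u (- R, y, t - 2 * ((R + x) * y)) \<le> K2"
        using xt by (intro K1 K2; linarith)+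
      then show "u ((x, y, t) \<odot> hexp ((R - x) *\<^sub>R (1, 0))) \<le> max K1 K2"
        "u ((x, y, t) \<odot> hexp (- (R + x) *\<^sub>R (1, 0))) \<le> max K1 K2"
        by (auto simp: algebra_simps)
    qed (use xt R in auto)
    then show ?thesis by blast
  qed
  obtain K1 K2 where
    K1: "\<And>x t. \<bar>x\<bar> \<le> R \<Longrightarrow> \<bar>t\<bar> \<le> R + 4 * (R * R) \<Longrightarrow> u (x, R, t) \<le> K1" and
    K2: "\<And>x t. \<bar>x\<bar> \<le> R \<Longrightarrow> \<bar>t\<bar> \<le> R + 4 * (R * R) \<Longrightarrow> u (x, - R, t) \<le> K2"
    using edge by meson
  have "u (x, y, t) \<le> max K1 K2" if xyt: "\<bar>x\<bar> \<le> R" "\<bar>y\<bar> \<le> R" "\<bar>t\<bar> \<le> R" for x y t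
  proof (rule H_convex_le[OF u, where a = "R - y" and b = "R + y" and v = "(0, 1)"])
    have "\<bar>x * (R - y)\<bar> \<le> R * (2 * R)" "\<bar>x * (R + y)\<bar> \<le> R * (2 * R)"
      using xyt by (intro abs_mult_le; linarith)+
    then have "u (x, R, t - 2 * (x * (R - y))) \<le> K1" "u (x, - R, t + 2 * (x * (R + y))) \<le> K2"
      using xyt by (intro K1 K2; linarith)+
    then show "u ((x, y, t) \<odot> hexp ((R - y) *\<^sub>R (0, 1))) \<le> max K1 K2"
      "u ((x, y, t) \<odot> hexp (- (R + y) *\<^sub>R (0, 1))) \<le> max K1 K2"
      by (auto simp: algebra_simps)
  qed (use xyt R in auto)
  then show ?thesis by blast
qed

text \<open>If \<open>K\<close> bounds \<open>u\<close> at both far ends, a step of relative length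
  \<open>d\<close> changes the gap \<open>K - u\<close> by a factor between \<open>1 - d\<close> and
  \<open>1 + d\<close>. Such multiplicative estimates compose along a path.\<close>

lemma H_convex_gap_step:
  assumes u: "H_convex u" and d: "0 < d" "d \<le> 1"
    and K: "u (g \<odot> hexp z) \<le> K" "u (g \<odot> hexp (- z)) \<le> K"
  shows "(1 - d) * (K - u g) \<le> K - u (g \<odot> hexp (d *\<^sub>R z))"
    and "K - u (g \<odot> hexp (d *\<^sub>R z)) \<le> (1 + d) * (K - u g)"
proof -
  have "u (g \<odot> hexp (d *\<^sub>R z)) \<le> u g + d * (u (g \<odot> hexp z) - u g)"
    using H_convexD u d by simp
  also have "\<dots> \<le> u g + d * (K - u g)"
    using K d by simp
  finally show "(1 - d) * (K - u g) \<le> K - u (g \<odot> hexp (d *\<^sub>R z))"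
    by (simp add: algebra_simps)
  have "(d + 1) * u g \<le> d * u (g \<odot> hexp (- z)) + u (g \<odot> hexp (d *\<^sub>R z))"
    using H_convex_between[OF u, of d 1 g z] d by simp
  also have "\<dots> \<le> d * K + u (g \<odot> hexp (d *\<^sub>R z))"
    using K d by simp
  finally show "K - u (g \<odot> hexp (d *\<^sub>R z)) \<le> (1 + d) * (K - u g)"
    by (simp add: algebra_simps)
qed

text \<open>Points near \<open>0\<close> are reached by five horizontal steps of size at most
  \<open>d\<close> in each coordinate, so the gap \<open>K - u\<close> varies by a factor between
  \<open>(1 - d) ^ 5\<close> and \<open>(1 + d) ^ 5\<close>, and both tend to 1.\<close>

lemma H_convex_isCont_0:
  assumes u: "H_convex u"
  shows "isCont u 0"
proof -
  \<comment> \<open>A unit step from |X|, |Y| \<le> 2, |T| \<le> 6 moves the last coordinate by at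
    most 2 * 4, hence stays within 14.\<close>
  obtain K where K: "\<And>x y t. \<bar>x\<bar> \<le> 14 \<Longrightarrow> \<bar>y\<bar> \<le> 14 \<Longrightarrow> \<bar>t\<bar> \<le> 14 \<Longrightarrow> u (x, y, t) \<le> K"
    using H_convex_bounded_above_box[OF u, of 14] by auto
  have step: "(1 - d) * (K - u (X, Y, T)) \<le> K - u ((X, Y, T) \<odot> hexp (a, b))
      \<and> K - u ((X, Y, T) \<odot> hexp (a, b)) \<le> (1 + d) * (K - u (X, Y, T))"
    if d: "0 < d" "d \<le> 1" and XYT: "\<bar>X\<bar> \<le> 2" "\<bar>Y\<bar> \<le> 2" "\<bar>T\<bar> \<le> 6" and ab: "\<bar>a\<bar> \<le> d" "\<bar>b\<bar> \<le> d"
    for d X Y T a b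
  proof -
    define z1 z2 where z: "z1 = a / d" "z2 = b / d"
    have le1: "\<bar>z1\<bar> \<le> 1" "\<bar>z2\<bar> \<le> 1"
      using ab d by (auto simp: z)
    have "\<bar>z1 * Y\<bar> \<le> 1 * 2" "\<bar>X * z2\<bar> \<le> 2 * 1"
      using le1 XYT by (intro abs_mult_le; simp)+
    then have "\<bar>z1 * Y - X * z2\<bar> \<le> 4"
      by linarith
    then have "u (X + z1, Y + z2, T + 2 * (z1 * Y - X * z2)) \<le> K"
      "u (X - z1, Y - z2, T - 2 * (z1 * Y - X * z2)) \<le> K"
      using le1 XYT by (auto intro!: K simp: abs_le_iff)
    then have "u ((X, Y, T) \<odot> hexp (z1, z2)) \<le> K" "u ((X, Y, T) \<odot> hexp (- (z1, z2))) \<le> K"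
      by (auto simp: algebra_simps)
    from H_convex_gap_step[OF u d this] show ?thesis
      using d by (simp add: z)
  qed
  have bounds: "(1 - d) ^ 5 * (K - u 0) \<le> K - u (x, y, t) \<and> K - u (x, y, t) \<le> (1 + d) ^ 5 * (K - u 0)"
    if d: "0 < d" "d \<le> 1" and xyt: "\<bar>x\<bar> \<le> d" "\<bar>y\<bar> \<le> d" "\<bar>t\<bar> \<le> 4 * (d * d)" for d x y t
  proof -
    \<comment> \<open>The bound 4 d d on |t| is exactly what keeps this commutator step of size at
      most \<open>d\<close>.\<close>
    define b where "b = - t / (4 * d)"
    have b: "\<bar>b\<bar> \<le> d"
      using xyt d by (simp add: b_def field_simps)
    have t: "t = - 4 * (d * b)"
      using d by (simp add: b_def)
    have 1: "\<bar>x\<bar> \<le> 1" "\<bar>y\<bar> \<le> 1" "\<bar>b\<bar> \<le> 1"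
      using xyt d b by auto
    have prods: "\<bar>d * y\<bar> \<le> 1 * 1" "\<bar>(x + d) * b\<bar> \<le> 2 * 1" "\<bar>x * b\<bar> \<le> 1 * 1" "\<bar>d * b\<bar> \<le> 1 * 1"
      using 1 d by (intro abs_mult_le; linarith)+
    have lin: "\<bar>x + d\<bar> \<le> 2" "\<bar>y + b\<bar> \<le> 2" "\<bar>2 * (d * y)\<bar> \<le> 6"
      "\<bar>2 * (d * y) - 2 * ((x + d) * b)\<bar> \<le> 6" "\<bar>- 2 * (x * b) - 4 * (d * b)\<bar> \<le> 6"
      "\<bar>x\<bar> \<le> 2" "\<bar>y\<bar> \<le> 2" "\<bar>0::real\<bar> \<le> 2" "\<bar>0::real\<bar> \<le> 6" "\<bar>x\<bar> \<le> d" "\<bar>y\<bar> \<le> d"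
      "\<bar>b\<bar> \<le> d" "\<bar>- b\<bar> \<le> d" "\<bar>d\<bar> \<le> d" "\<bar>- d\<bar> \<le> d" "\<bar>0\<bar> \<le> d"
      using 1 b d xyt(1,2) prods by linarith+
    \<comment> \<open>Intermediate points of the five-step word ending at
      \<open>(x, y, t)\<close>.\<close>
    define g1 g2 g3 g4 :: heis where g: "g1 = (x, y, 0)" "g2 = (x + d, y, 2 * (d * y))"
      "g3 = (x + d, y + b, 2 * (d * y) - 2 * ((x + d) * b))"
      "g4 = (x, y + b, - 2 * (x * b) - 4 * (d * b))"
    have "g1 = (0, 0, 0) \<odot> hexp (x, y)" "g2 = g1 \<odot> hexp (d, 0)" "g3 = g2 \<odot> hexp (0, b)"
      "g4 = g3 \<odot> hexp (- d, 0)" "(x, y, t) = g4 \<odot> hexp (0, - b)"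
      by (auto simp: g t algebra_simps)
    then have
      s: "(1 - d) * (K - u 0) \<le> K - u g1 \<and> K - u g1 \<le> (1 + d) * (K - u 0)"
      "(1 - d) * (K - u g1) \<le> K - u g2 \<and> K - u g2 \<le> (1 + d) * (K - u g1)"
      "(1 - d) * (K - u g2) \<le> K - u g3 \<and> K - u g3 \<le> (1 + d) * (K - u g2)"
      "(1 - d) * (K - u g3) \<le> K - u g4 \<and> K - u g4 \<le> (1 + d) * (K - u g3)"
      "(1 - d) * (K - u g4) \<le> K - u (x, y, t) \<and> K - u (x, y, t) \<le> (1 + d) * (K - u g4)"
      using step[OF d, of 0 0 0 x y] step[OF d, of x y 0 d 0] step[OF d, of "x + d" y "2 * (d * y)" 0 b]
        step[OF d, of "x + d" "y + b" "2 * (d * y) - 2 * ((x + d) * b)" "- d" 0]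
        step[OF d, of x "y + b" "- 2 * (x * b) - 4 * (d * b)" 0 "- b"] lin
      by (simp_all only: g zero_prod_def)
    have lo: "(1 - d) ^ Suc n * m \<le> q" if "(1 - d) ^ n * m \<le> p" "(1 - d) * p \<le> q" for n m p q
      using mult_left_mono[OF that(1), of "1 - d"] that(2) d by (simp add: mult.assoc)
    have hi: "q \<le> (1 + d) ^ Suc n * m" if "p \<le> (1 + d) ^ n * m" "q \<le> (1 + d) * p" for n m p q
    proof -
      have "(1 + d) * p \<le> (1 + d) * ((1 + d) ^ n * m)"
        using that(1) d by (intro mult_left_mono) auto
      then show ?thesis
        using that(2) by (simp only: power_Suc mult.assoc)
    qed
    note s1 = s[THEN conjunct1] and s2 = s[THEN conjunct2]
    have "(1 - d) ^ 1 * (K - u 0) \<le> K - u g1" "K - u g1 \<le> (1 + d) ^ 1 * (K - u 0)"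
      using s(1) by simp_all
    from lo[OF lo[OF lo[OF lo[OF this(1) s1(2)] s1(3)] s1(4)] s1(5)]
      hi[OF hi[OF hi[OF hi[OF this(2) s2(2)] s2(3)] s2(4)] s2(5)]
    show ?thesis
      by (simp add: eval_nat_numeral)
  qed
  show ?thesis
    unfolding isCont_def
  proof (rule tendstoI)
    fix e :: real
    assume e: "e > 0"
    have "((\<lambda>d. (1 - d) ^ 5 * (K - u 0)) \<longlongrightarrow> (1 - 0) ^ 5 * (K - u 0)) (at_right 0)"
      "((\<lambda>d. (1 + d) ^ 5 * (K - u 0)) \<longlongrightarrow> (1 + 0) ^ 5 * (K - u 0)) (at_right 0)"
      by (intro tendsto_intros)+
    then have "\<forall>\<^sub>F d in at_right 0. (1 - d) ^ 5 * (K - u 0) > K - u 0 - e"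
      "\<forall>\<^sub>F d in at_right 0. (1 + d) ^ 5 * (K - u 0) < K - u 0 + e"
      using e by (auto intro: order_tendstoD)
    moreover have "\<forall>\<^sub>F d in at_right 0. 0 < d \<and> d < (1::real)"
      by (auto simp: eventually_at_right_field intro: exI[of _ 1])
    ultimately have "\<forall>\<^sub>F d in at_right 0. (1 - d) ^ 5 * (K - u 0) > K - u 0 - e
        \<and> (1 + d) ^ 5 * (K - u 0) < K - u 0 + e \<and> 0 < d \<and> d < 1"
      by eventually_elim auto
    then obtain d where d: "(1 - d) ^ 5 * (K - u 0) > K - u 0 - e"
      "(1 + d) ^ 5 * (K - u 0) < K - u 0 + e" "0 < d" "d < 1"
      using eventually_happens'[OF trivial_limit_at_right_real] by blast
    have "((\<lambda>g::heis. \<bar>fst g\<bar>) \<longlongrightarrow> \<bar>fst (0::heis)\<bar>) (at 0)"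
      "((\<lambda>g::heis. \<bar>fst (snd g)\<bar>) \<longlongrightarrow> \<bar>fst (snd (0::heis))\<bar>) (at 0)"
      "((\<lambda>g::heis. \<bar>snd (snd g)\<bar>) \<longlongrightarrow> \<bar>snd (snd (0::heis))\<bar>) (at 0)"
      by (intro tendsto_intros)+
    then have "\<forall>\<^sub>F g::heis in at 0. \<bar>fst g\<bar> < d" "\<forall>\<^sub>F g::heis in at 0. \<bar>fst (snd g)\<bar> < d"
      "\<forall>\<^sub>F g::heis in at 0. \<bar>snd (snd g)\<bar> < 4 * (d * d)"
      using d by (auto intro: order_tendstoD)
    then show "\<forall>\<^sub>F g in at 0. dist (u g) (u 0) < e"
    proof eventually_elim
      case (elim g)
      then show ?case
        using bounds[of d "fst g" "fst (snd g)" "snd (snd g)"] d by (auto simp: dist_real_def)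
    qed
  qed
qed

lemma tendsto_heis_mult:
  assumes "(f \<longlongrightarrow> a) F" "(h \<longlongrightarrow> b) F"
  shows "((\<lambda>s. f s \<odot> h s) \<longlongrightarrow> a \<odot> b) F"
proof -
  have eq: "p \<odot> q = (fst p + fst q, fst (snd p) + fst (snd q), snd (snd p) + snd (snd q)
    + 2 * (fst q * fst (snd p) - fst p * fst (snd q)))" for p q
    by (cases p; cases q) simp
  show ?thesis
    unfolding eq by (intro tendsto_intros assms)
qed

lemma tendsto_hexp:
  assumes "(f \<longlongrightarrow> a) F"
  shows "((\<lambda>s. hexp (f s)) \<longlongrightarrow> hexp a) F"
proof -
  have eq: "hexp w = (fst w, snd w, 0)" for w
    by (cases w) simp
  show ?thesis
    unfolding eq by (intro tendsto_intros assms)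
qed

lemma H_convex_isCont:
  assumes u: "H_convex u"
  shows "isCont u h"
proof -
  have "((\<lambda>g. - h \<odot> g) \<longlongrightarrow> - h \<odot> h) (at h)"
    by (intro tendsto_heis_mult tendsto_intros)
  moreover have "- h \<odot> h = 0"
    by (cases h) (simp add: zero_prod_def)
  ultimately have "((\<lambda>g. u (h \<odot> (- h \<odot> g))) \<longlongrightarrow> u (h \<odot> 0)) (at h)"
    using isCont_tendsto_compose[OF H_convex_isCont_0[OF H_convex_translate[OF u, of h]],
      of "\<lambda>g. - h \<odot> g"] by simp
  then show ?thesis
    by (simp add: heis_mult_uminus_cancel isCont_def)
qed

section \<open>Closed horizontal paths and nonempty subdifferentials\<close>

primrec hpath :: "V1 list \<Rightarrow> heis" where
  "hpath [] = 0"
| "hpath (z # zs) = hexp z \<odot> hpath zs"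

lemma hpath_append: "hpath (xs @ ys) = hpath xs \<odot> hpath ys"
  by (induction xs) (simp_all add: heis_mult_assoc)

lemma xi1_hpath: "\<xi>1 (hpath zs) = sum_list zs"
proof (induction zs)
  case (Cons z zs)
  have "\<xi>1 (a \<odot> b) = \<xi>1 a + \<xi>1 b" "\<xi>1 (hexp w) = w" for a b w
    by (cases a; cases b; cases w; simp)+
  then show ?case
    using Cons by simp
qed (simp add: zero_prod_def)

fun heis_flip :: "heis \<Rightarrow> heis" where
  "heis_flip (x, y, t) = (x, y, - t)"

lemma heis_flip_mult: "heis_flip (a \<odot> b) = heis_flip b \<odot> heis_flip a"
  by (cases a; cases b) (simp add: algebra_simps)

text \<open>\<open>heis_flip\<close> reverses products and fixes every \<open>hexp z\<close>, so it
  turns a word into its reversal.\<close>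

lemma hpath_rev: "hpath (rev zs) = heis_flip (hpath zs)"
proof (induction zs)
  case (Cons z zs)
  have "heis_flip (hexp z) = hexp z"
    by (cases z) simp
  then show ?case
    by (simp add: Cons hpath_append heis_flip_mult)
qed (simp add: zero_prod_def)

lemma hpath_palindrome_eq_0:
  assumes "sum_list zs = 0"
  shows "hpath (zs @ rev zs) = 0"
proof -
  obtain t where "hpath zs = (0, 0, t)"
    using xi1_hpath[of zs] assms by (cases "hpath zs") (auto simp: zero_prod_def)
  then show ?thesis
    by (simp add: hpath_append hpath_rev zero_prod_def)
qed

text \<open>By continuity the increments \<open>u (g \<odot> hexp (w i)) - u g\<close> stay below \<open>a i\<close> for \<open>g\<close>
  near \<open>0\<close>, so along a short path every step raises \<open>u\<close> by at most its share of \<open>a i\<close>.\<close>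

lemma H_convex_short_path:
  assumes u: "H_convex u"
    and "\<And>i. i \<in> set is \<Longrightarrow> 0 \<le> c i \<and> u (hexp (w i)) - u 0 < a i"
    and "(h \<longlongrightarrow> 0) (at_right (0::real))"
  shows "\<forall>\<^sub>F s in at_right 0. u (h s \<odot> hpath (map (\<lambda>i. (s * c i) *\<^sub>R w i) is))
    \<le> u (h s) + s * (\<Sum>i\<leftarrow>is. c i * a i)"
  using assms(2,3)
proof (induction "is" arbitrary: h)
  case Nil
  then show ?case by simp
next
  case (Cons i "is")
  have i: "0 \<le> c i" "u (hexp (w i)) - u 0 < a i"
    using Cons.prems(1) by auto
  \<comment> \<open>The induction lets the base point depend on \<open>s\<close>: after one short
    step it still tends to \<open>0\<close>, so the hypothesis applies to \<open>h'\<close>.\<close>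
  define h' where "h' s = h s \<odot> hexp ((s * c i) *\<^sub>R w i)" for s
  have "(h' \<longlongrightarrow> 0 \<odot> hexp ((0 * c i) *\<^sub>R w i)) (at_right 0)"
    unfolding h'_def by (intro tendsto_heis_mult tendsto_hexp Cons.prems(2) tendsto_intros)
  then have IH: "\<forall>\<^sub>F s in at_right 0. u (h' s \<odot> hpath (map (\<lambda>i. (s * c i) *\<^sub>R w i) is))
      \<le> u (h' s) + s * (\<Sum>i\<leftarrow>is. c i * a i)"
    using Cons.prems(1) by (intro Cons.IH) auto
  have "((\<lambda>s. h s \<odot> hexp (w i)) \<longlongrightarrow> 0 \<odot> hexp (w i)) (at_right 0)"
    by (intro tendsto_heis_mult Cons.prems(2) tendsto_intros)
  then have "((\<lambda>s. u (h s \<odot> hexp (w i)) - u (h s)) \<longlongrightarrow> u (0 \<odot> hexp (w i)) - u 0) (at_right 0)"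
    by (intro tendsto_diff isCont_tendsto_compose[OF H_convex_isCont[OF u]] Cons.prems(2))
  then have "\<forall>\<^sub>F s in at_right 0. u (h s \<odot> hexp (w i)) - u (h s) < a i"
    using i by (intro order_tendstoD) auto
  \<comment> \<open>Once \<open>s * c i < 1\<close>, the step is a fraction of the full step
    \<open>w i\<close>, and \<open>H_convexD\<close> compares the two.\<close>
  moreover have "((\<lambda>s. s * c i) \<longlongrightarrow> 0 * c i) (at_right 0)"
    by (intro tendsto_intros)
  then have "\<forall>\<^sub>F s in at_right 0. s * c i < 1"
    by (intro order_tendstoD) auto
  moreover have "\<forall>\<^sub>F s in at_right (0::real). 0 < s"
    by (rule eventually_at_right_less)
  ultimately show ?case
    using IH
  proof eventually_elim
    case (elim s)
    have "u (h' s) \<le> u (h s) + (s * c i) * (u (h s \<odot> hexp (w i)) - u (h s))"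
      unfolding h'_def using elim i by (intro H_convexD[OF u]) auto
    also have "\<dots> \<le> u (h s) + (s * c i) * a i"
      using elim i by (intro add_left_mono mult_left_mono) auto
    finally show ?case
      using elim(4) by (simp add: h'_def heis_mult_assoc algebra_simps)
  qed
qed

lemma H_convex_weighted_increments:
  assumes u: "H_convex u" and I: "finite I" "\<And>i. i \<in> I \<Longrightarrow> 0 \<le> c i" "(\<Sum>i\<in>I. c i *\<^sub>R w i) = 0"
    and a: "\<And>i. i \<in> I \<Longrightarrow> u (hexp (w i)) - u 0 < a i"
  shows "0 \<le> (\<Sum>i\<in>I. c i * a i)"
proof -
  obtain "is" where xs: "set is = I" "distinct is"
    using finite_distinct_list[OF I(1)] by blast
  define A where "A = (\<Sum>i\<in>I. c i * a i)"
  have A: "(\<Sum>i\<leftarrow>is. c i * a i) = A"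
    unfolding A_def xs(1)[symmetric] by (rule sum_list_distinct_conv_sum_set[OF xs(2)])
  have closed: "hpath (map (\<lambda>i. (s * c i) *\<^sub>R w i) (is @ rev is)) = 0" for s
  proof -
    have "sum_list (map (\<lambda>i. (s * c i) *\<^sub>R w i) is) = s *\<^sub>R (\<Sum>i\<in>I. c i *\<^sub>R w i)"
      unfolding sum_list_distinct_conv_sum_set[OF xs(2)] xs(1)
      by (simp add: scaleR_sum_right)
    then show ?thesis
      using hpath_palindrome_eq_0[of "map (\<lambda>i. (s * c i) *\<^sub>R w i) is"] I(3) by (simp add: rev_map)
  qed
  have "\<forall>\<^sub>F s in at_right 0. u (0 \<odot> hpath (map (\<lambda>i. (s * c i) *\<^sub>R w i) (is @ rev is)))
      \<le> u 0 + s * (\<Sum>i\<leftarrow>is @ rev is. c i * a i)"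
    by (rule H_convex_short_path[OF u]) (use I a xs in auto)
  moreover have "\<forall>\<^sub>F s in at_right (0::real). 0 < s"
    by (rule eventually_at_right_less)
  \<comment> \<open>The loop returns to \<open>0\<close>, so its total rise is zero, while it is
    bounded by \<open>2 * s * A\<close>.\<close>
  ultimately have "\<forall>\<^sub>F s in at_right (0::real). 0 \<le> A"
  proof eventually_elim
    case (elim s)
    have "(\<Sum>i\<leftarrow>is @ rev is. c i * a i) = 2 * A"
      by (simp add: A rev_map[symmetric] sum_list_rev)
    then show ?case
      using elim unfolding closed by (simp add: zero_le_mult_iff)
  qed
  then show ?thesis
    by (simp add: A_def)
qed

lemma H_subdiff_0_nonempty:
  assumes u: "H_convex u"
  shows "H_subdiff u 0 \<noteq> {}"
proof -
  define \<psi> where "\<psi> w = u (hexp w) - u 0" for w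
  define S where "S = {p. \<psi> (fst p) < snd p}"
  have "0 \<notin> convex hull S"
  proof
    assume "0 \<in> convex hull S"
    then obtain I c where I: "finite I" "I \<subseteq> S" "\<forall>p\<in>I. 0 \<le> c p" "sum c I = 1"
      "(\<Sum>p\<in>I. c p *\<^sub>R p) = 0"
      unfolding convex_hull_explicit by auto
    have "(\<Sum>p\<in>I. c p *\<^sub>R fst p) = fst (\<Sum>p\<in>I. c p *\<^sub>R p)"
      by (simp add: fst_sum)
    moreover have snd: "(\<Sum>p\<in>I. c p * snd p) = snd (\<Sum>p\<in>I. c p *\<^sub>R p)"
      by (simp add: snd_sum)
    \<comment> \<open>The midpoint leaves slack on both sides: it lies strictly above \<psi>, as
      \<open>H_convex_weighted_increments\<close> demands, and strictly below \<open>snd p\<close>,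
      which yields the contradiction.\<close>
    ultimately have "0 \<le> (\<Sum>p\<in>I. c p * ((\<psi> (fst p) + snd p) / 2))"
      using I by (intro H_convex_weighted_increments[OF u, where w = fst]) (auto simp: S_def \<psi>_def)
    also have "\<dots> < (\<Sum>p\<in>I. c p * snd p)"
    proof (rule sum_strict_mono_ex1[OF I(1)])
      show "\<forall>p\<in>I. c p * ((\<psi> (fst p) + snd p) / 2) \<le> c p * snd p"
      proof
        fix p
        assume "p \<in> I"
        with I have "0 \<le> c p" "\<psi> (fst p) < snd p"
          by (auto simp: S_def)
        then show "c p * ((\<psi> (fst p) + snd p) / 2) \<le> c p * snd p"
          by (intro mult_left_mono) auto
      qed
      obtain p where p: "p \<in> I" "c p \<noteq> 0"
        using I(4) by (metis sum.neutral zero_neq_one)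
      then have "c p > 0" "\<psi> (fst p) < snd p"
        using I by (auto simp: S_def less_le)
      then show "\<exists>p\<in>I. c p * ((\<psi> (fst p) + snd p) / 2) < c p * snd p"
        using p by (intro bexI[of _ p]) auto
    qed
    finally show False
      using snd I(5) by simp
  qed
  then obtain n where n: "n \<noteq> 0" "\<forall>p\<in>convex hull S. 0 \<le> n \<bullet> p"
    using separating_hyperplane_set_0[of "convex hull S"] by (auto simp: convex_convex_hull)
  define b c where bc: "b = fst n" "c = snd n"
  have pos: "0 \<le> b \<bullet> w + c * r" if "\<psi> w < r" for w r
    using n(2)[rule_format, OF hull_inc[of "(w, r)"]] that
    by (simp add: S_def bc inner_prod_def)
  \<comment> \<open>The separating plane is not vertical, because the epigraph has points over every
    \<open>w\<close>, in particular over \<open>- b\<close>.\<close>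
  have "c > 0"
  proof (rule ccontr)
    assume "\<not> c > 0"
    moreover have "c \<ge> 0"
      using pos[of 0 1] by (simp add: \<psi>_def)
    ultimately have c: "c = 0"
      by simp
    have "0 \<le> b \<bullet> (- b)"
      using pos[of "- b" "\<psi> (- b) + 1"] c by simp
    then have "b = 0"
      by (simp add: inner_gt_zero_iff flip: not_less)
    with c n(1) show False
      by (simp add: bc prod_eq_iff)
  qed
  \<comment> \<open>The epigraph is strict, so the bound at \<psi> itself needs a limit from
    above.\<close>
  have "- (b \<bullet> w) / c \<le> \<psi> w" for w
  proof (rule field_le_epsilon)
    fix e :: real
    assume "e > 0"
    then show "- (b \<bullet> w) / c \<le> \<psi> w + e"
      using pos[of w "\<psi> w + e"] \<open>c > 0\<close> by (simp add: field_simps)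
  qed
  then have "(- (1 / c)) *\<^sub>R b \<in> H_subdiff u 0"
    by (intro H_subdiffI) (simp add: \<psi>_def algebra_simps)
  then show ?thesis by blast
qed

lemma H_subdiff_nonempty:
  assumes u: "H_convex u"
  shows "H_subdiff u g \<noteq> {}"
proof -
  have "H_subdiff (\<lambda>h. u (g \<odot> h)) 0 = H_subdiff u g"
    by (simp add: H_subdiff_def)
  then show ?thesis
    using H_subdiff_0_nonempty[OF H_convex_translate[OF u, of g]] by simp
qed

section \<open>Cyclic monotonicity and maximality\<close>

lemma H_subdiff_ineq:
  assumes "v \<in> H_subdiff u g" "g' \<in> hplane g"
  shows "u g + v \<bullet> (\<xi>1 g' - \<xi>1 g) \<le> u g'"
proof -
  obtain w where w: "g' = g \<odot> hexp w"
    using assms(2) unfolding mem_hplane_iff by blast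
  show ?thesis
    using H_subdiffD[OF assms(1), of w] unfolding w xi1_mult_hexp by simp
qed

text \<open>The subgradient inequalities, summed around the loop, telescope to zero.\<close>

lemma H_subdiff_cyclically_monotone: "H_cyclically_monotone (H_subdiff u)"
  unfolding H_cyclically_monotone_def
proof (intro allI impI)
  fix n :: nat and g v
  assume gv: "\<forall>i\<le>n. (g i, v i) \<in> sv_gph (H_subdiff u)" and cl: "closed_H_seq n g"
  define next' where "next' i = (if i = n then g 0 else g (Suc i))" for i
  have "v i \<bullet> (\<xi>1 (next' i) - \<xi>1 (g i)) \<le> u (next' i) - u (g i)" if "i \<le> n" for i
  proof -
    have "next' i \<in> hplane (g i)"
      using cl that hplane_sym by (auto simp: closed_H_seq_def next'_def)
    moreover have "v i \<in> H_subdiff u (g i)"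
      using gv that by (auto simp: sv_gph_def)
    ultimately show ?thesis
      using H_subdiff_ineq by fastforce
  qed
  then have "(\<Sum>i=0..n. v i \<bullet> (\<xi>1 (next' i) - \<xi>1 (g i))) \<le> (\<Sum>i=0..n. u (next' i) - u (g i))"
    by (intro sum_mono) auto
  also have "(\<Sum>i=0..n. u (next' i) - u (g i)) = (\<Sum>i<n. u (g (Suc i)) - u (g i)) + (u (g 0) - u (g n))"
    by (simp add: atLeast0AtMost lessThan_Suc_atMost[symmetric] next'_def)
  also have "\<dots> = 0"
    using sum_lessThan_telescope[of "\<lambda>i. u (g i)" n] by simp
  finally show "(\<Sum>i=0..n. \<xi>1 (if i = n then g 0 else g (Suc i)) \<bullet> v i) \<le> (\<Sum>i=0..n. \<xi>1 (g i) \<bullet> v i)"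
    by (simp add: next'_def[symmetric] inner_diff_right sum_subtractf inner_commute)
qed

text \<open>Monotonicity is the case of the two-point loop \<open>g\<close>,
  \<open>g'\<close>.\<close>

lemma H_cyclically_monotone_imp_H_monotone:
  assumes "H_cyclically_monotone T"
  shows "H_monotone T"
  unfolding H_monotone_def
proof (intro ballI)
  fix g g' v v'
  assume *: "g \<in> sv_dom T" "g' \<in> sv_dom T \<inter> hplane g" "v \<in> T g" "v' \<in> T g'"
  let ?g = "\<lambda>i::nat. if i = 0 then g else g'" and ?v = "\<lambda>i::nat. if i = 0 then v else v'"
  have "closed_H_seq 1 ?g"
    using * by (auto simp: closed_H_seq_def)
  moreover have "\<forall>i\<le>1. (?g i, ?v i) \<in> sv_gph T"
    using * by (auto simp: sv_gph_def)
  ultimately have "(\<Sum>i=0..1. \<xi>1 (if i = 1 then ?g 0 else ?g (Suc i)) \<bullet> ?v i)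
      \<le> (\<Sum>i=0..1. \<xi>1 (?g i) \<bullet> ?v i)"
    using assms[unfolded H_cyclically_monotone_def, rule_format, of 1 ?g ?v] by simp
  then show "0 \<le> (v' - v) \<bullet> (\<xi>1 g' - \<xi>1 g)"
    by (simp add: inner_diff_left inner_diff_right inner_commute)
qed

text \<open>Minty's argument on a horizontal line: a subgradient \<open>v\<close> at
  \<open>g \<odot> hexp (s *\<^sub>R w)\<close> satisfies
  \<open>v0 \<bullet> w \<le> v \<bullet> w\<close> by monotonicity, so its inequality towards
  \<open>g \<odot> hexp w\<close> also holds with \<open>v0\<close>. Continuity of \<open>u\<close>
  then lets \<open>s\<close> tend to 0.\<close>

lemma H_subdiff_absorbs:
  assumes u: "H_convex u" and T: "H_monotone T" "\<And>g. H_subdiff u g \<subseteq> T g"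
  shows "T g \<subseteq> H_subdiff u g"
proof
  fix v0
  assume v0: "v0 \<in> T g"
  show "v0 \<in> H_subdiff u g"
    unfolding H_subdiff_def
  proof safe
    fix w
    define f where "f s = u (g \<odot> hexp (s *\<^sub>R w))" for s :: real
    have ineq: "f s + (1 - s) * (v0 \<bullet> w) \<le> f 1" if s: "0 < s" "s < 1" for s
    proof -
      define p where "p = g \<odot> hexp (s *\<^sub>R w)"
      obtain v where v: "v \<in> H_subdiff u p"
        using H_subdiff_nonempty[OF u, of p] by blast
      have "p \<odot> hexp ((1 - s) *\<^sub>R w) = g \<odot> hexp (1 *\<^sub>R w)"
        unfolding p_def heis_mult_assoc hexp_mult_collinear by simp
      then have "f s + v \<bullet> ((1 - s) *\<^sub>R w) \<le> f 1"
        using H_subdiffD[OF v, of "(1 - s) *\<^sub>R w"] unfolding f_def p_def[symmetric] by simp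
      moreover have "v \<in> T p" "p \<in> hplane g"
        using v T(2) mult_hexp_mem_hplane unfolding p_def by blast+
      then have "0 \<le> (v - v0) \<bullet> (\<xi>1 p - \<xi>1 g)"
        using T(1) v0 unfolding H_monotone_def sv_dom_def by blast
      then have "v0 \<bullet> w \<le> v \<bullet> w"
        using s by (simp add: p_def inner_diff_left zero_le_mult_iff)
      then have "(1 - s) * (v0 \<bullet> w) \<le> (1 - s) * (v \<bullet> w)"
        using s by (intro mult_left_mono) auto
      ultimately show ?thesis by simp
    qed
    have "((\<lambda>s. g \<odot> hexp (s *\<^sub>R w)) \<longlongrightarrow> g \<odot> hexp (0 *\<^sub>R w)) (at_right 0)"
      by (intro tendsto_heis_mult tendsto_hexp tendsto_intros)
    then have "(f \<longlongrightarrow> f 0) (at_right 0)"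
      unfolding f_def by (rule isCont_tendsto_compose[OF H_convex_isCont[OF u]])
    then have "((\<lambda>s. f s + (1 - s) * (v0 \<bullet> w)) \<longlongrightarrow> f 0 + (1 - 0) * (v0 \<bullet> w)) (at_right 0)"
      by (intro tendsto_intros)
    moreover have "\<forall>\<^sub>F s in at_right 0. f s + (1 - s) * (v0 \<bullet> w) \<le> f 1"
      using ineq by (auto simp: eventually_at_right_field intro!: exI[of _ 1])
    ultimately have "f 0 + (1 - 0) * (v0 \<bullet> w) \<le> f 1"
      by (rule tendsto_upperbound) simp
    then show "u g + v0 \<bullet> w \<le> u (g \<odot> hexp w)"
      by (simp add: f_def)
  qed
qed

lemma H_subdiff_maximal_H_monotone:
  assumes "H_convex u"
  shows "maximal_H_monotone (H_subdiff u)"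
  unfolding maximal_H_monotone_def
  using H_subdiff_cyclically_monotone H_cyclically_monotone_imp_H_monotone H_subdiff_absorbs[OF assms]
  by (metis psubsetE)

text \<open>A cyclically monotone extension is in particular H-monotone, so
  \<open>H_subdiff_absorbs\<close> covers it as well.\<close>

lemma H_subdiff_maximal_H_cyclically_monotone:
  assumes "H_convex u"
  shows "maximal_H_cyclically_monotone (H_subdiff u)"
  unfolding maximal_H_cyclically_monotone_def
  using H_subdiff_cyclically_monotone H_cyclically_monotone_imp_H_monotone H_subdiff_absorbs[OF assms]
  by (metis psubsetE)

section \<open>Rockafellar's potential along horizontal chains\<close>

text \<open>The real argument is the Rockafellar sum of a horizontal chain from \<open>a\<close>;
  each slope is taken at the point being left, not at the one reached.\<close>

inductive hchain :: "(heis \<Rightarrow> V1 set) \<Rightarrow> heis \<Rightarrow> real \<Rightarrow> heis \<Rightarrow> bool" for T a where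
  refl: "hchain T a 0 a"
| step: "hchain T a r g \<Longrightarrow> v \<in> T g \<Longrightarrow> hchain T a (r + v \<bullet> w) (g \<odot> hexp w)"

lemma hchain_trans:
  assumes "hchain T b s c" "hchain T a r b"
  shows "hchain T a (r + s) c"
  using assms
proof (induction rule: hchain.induct)
  case (step s g v w)
  then show ?case
    using hchain.step[of T a "r + s" g v w] by (simp add: add.assoc)
qed simp

text \<open>Full domain allows any horizontal step, and five of them, given by
  \<open>heis_word_decomposition\<close> with \<open>d = 1\<close>, join any two points.\<close>

lemma hchain_connected:
  assumes "\<And>g. T g \<noteq> {}"
  shows "\<exists>r. hchain T a r b"
proof -
  have step: "\<exists>r. hchain T a r (g \<odot> hexp w)" if "\<exists>r. hchain T a r g" for g w
    using that assms hchain.step by (metis ex_in_conv)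
  obtain x y t where xyt: "- a \<odot> b = (x, y, t)"
    by (cases "- a \<odot> b")
  have "b = a \<odot> (x, y, t)"
    by (simp add: heis_mult_uminus_cancel flip: xyt)
  also have "\<dots> = a \<odot> hexp (x, y) \<odot> hexp (1, 0) \<odot> hexp (0, - t / (4 * 1))
      \<odot> hexp (- 1, 0) \<odot> hexp (0, t / (4 * 1))"
    using heis_word_decomposition[of 1 x y t] by (simp only: heis_mult_assoc)
  finally show ?thesis
    using hchain.refl[of T a] by (blast intro: step)
qed

text \<open>Translates chains into the indexed sequences used by
  \<open>H_cyclically_monotone\<close>.\<close>

lemma hchain_sequence:
  assumes "hchain T a r b"
  shows "\<exists>k g v. g 0 = a \<and> g k = b
    \<and> (\<forall>i<k. v i \<in> T (g i) \<and> g (Suc i) \<in> hplane (g i))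
    \<and> r = (\<Sum>i<k. v i \<bullet> (\<xi>1 (g (Suc i)) - \<xi>1 (g i)))"
  using assms
proof (induction rule: hchain.induct)
  case refl
  then show ?case
    by (intro exI[of _ 0] exI[of _ "\<lambda>_. a"]) auto
next
  case (step r b v' w)
  then obtain k g v where IH: "g 0 = a" "g k = b"
    "\<forall>i<k. v i \<in> T (g i) \<and> g (Suc i) \<in> hplane (g i)"
    "r = (\<Sum>i<k. v i \<bullet> (\<xi>1 (g (Suc i)) - \<xi>1 (g i)))"
    by blast
  have "b \<odot> hexp w \<in> hplane b"
    by (rule mult_hexp_mem_hplane)
  then show ?case
    using IH step.hyps
    by (intro exI[of _ "Suc k"] exI[of _ "g(Suc k := b \<odot> hexp w)"] exI[of _ "v(k := v')"])
      (auto simp: less_Suc_eq)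
qed

lemma hchain_loop_nonpos:
  assumes T: "H_cyclically_monotone T" and "hchain T a r a"
  shows "r \<le> 0"
proof -
  obtain k g v where g: "g 0 = a" "g k = a"
    "\<And>i. i < k \<Longrightarrow> v i \<in> T (g i) \<and> g (Suc i) \<in> hplane (g i)"
    and r: "r = (\<Sum>i<k. v i \<bullet> (\<xi>1 (g (Suc i)) - \<xi>1 (g i)))"
    using hchain_sequence[OF assms(2)] by blast
  show ?thesis
  proof (cases "k \<le> 1")
    \<comment> \<open>A closed H-sequence has at least two points, so loops of at most one step are
      treated apart; their sum is 0.\<close>
    case True
    then have "k = 0 \<or> k = 1"
      by auto
    then show ?thesis
      using g r by auto
  next
    case False
    \<comment> \<open>The final point \<open>g k\<close> repeats \<open>g 0\<close> and is dropped,
      leaving the closed sequence \<open>g 0\<close>, ..., \<open>g n\<close>.\<close>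
    then obtain n where n: "k = Suc n" "n > 0"
      by (cases k) auto
    have "closed_H_seq n g"
      using g(3) g(3)[of n] g(1,2) n hplane_sym[of "g (Suc n)" "g n"]
      by (simp add: closed_H_seq_def)
    moreover have "\<forall>i\<le>n. (g i, v i) \<in> sv_gph T"
      using g(3) n by (auto simp: sv_gph_def sv_dom_def less_Suc_eq_le)
    ultimately have "(\<Sum>i=0..n. \<xi>1 (if i = n then g 0 else g (Suc i)) \<bullet> v i)
        \<le> (\<Sum>i=0..n. \<xi>1 (g i) \<bullet> v i)"
      using T unfolding H_cyclically_monotone_def by blast
    moreover have "(\<Sum>i=0..n. \<xi>1 (if i = n then g 0 else g (Suc i)) \<bullet> v i)
        = (\<Sum>i=0..n. \<xi>1 (g (Suc i)) \<bullet> v i)"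
      using g n by (intro sum.cong) auto
    ultimately show ?thesis
      by (simp add: r n lessThan_Suc_atMost atLeast0AtMost inner_diff_right sum_subtractf inner_commute)
  qed
qed

lemma H_cyclically_monotone_potential:
  assumes T: "H_cyclically_monotone T" and dom: "\<And>g. T g \<noteq> {}"
  obtains u where "\<And>g. T g \<subseteq> H_subdiff u g"
proof
  define R where "R g = {r. hchain T 0 r g}" for g
  have ne: "R g \<noteq> {}" for g
    using hchain_connected[of T, OF dom] by (auto simp: R_def)
  have bdd: "bdd_above (R g)" for g
  proof -
    \<comment> \<open>One fixed return chain closes every chain from \<open>0\<close> to
      \<open>g\<close> into a loop, which bounds all sums in \<open>R g\<close> by
      \<open>- s\<close>.\<close>
    obtain s where s: "hchain T g s 0"
      using hchain_connected[of T, OF dom] by blast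
    have "r \<le> - s" if "r \<in> R g" for r
      using hchain_loop_nonpos[OF T hchain_trans[OF s]] that by (force simp: R_def)
    then show ?thesis
      by (rule bdd_aboveI)
  qed
  fix g
  show "T g \<subseteq> H_subdiff (\<lambda>g. Sup (R g)) g"
    unfolding H_subdiff_def
  proof safe
    fix v w
    assume v: "v \<in> T g"
    have "r \<le> Sup (R (g \<odot> hexp w)) - v \<bullet> w" if "r \<in> R g" for r
    proof -
      have "r + v \<bullet> w \<in> R (g \<odot> hexp w)"
        using that v by (auto simp: R_def intro: hchain.step)
      then show ?thesis
        using cSup_upper[OF _ bdd] by fastforce
    qed
    then have "Sup (R g) \<le> Sup (R (g \<odot> hexp w)) - v \<bullet> w"
      by (intro cSup_least ne)
    then show "Sup (R g) + v \<bullet> w \<le> Sup (R (g \<odot> hexp w))"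
      by simp
  qed
qed

text \<open>A subgradient at the intermediate point \<open>p\<close> bounds \<open>u\<close> from
  below at both ends; in the convex combination the slope terms cancel.\<close>

lemma H_convex_if_H_subdiff_nonempty:
  assumes "\<And>g. H_subdiff u g \<noteq> {}"
  shows "H_convex u"
  unfolding H_convex_def
proof (intro allI ballI)
  fix g v and l :: real
  assume l: "l \<in> {0..1}"
  define p where "p = g \<odot> hexp (l *\<^sub>R v)"
  obtain s where s: "\<And>w. u p + s \<bullet> w \<le> u (p \<odot> hexp w)"
    using assms[of p] unfolding H_subdiff_def by blast
  have "p \<odot> hexp ((- l) *\<^sub>R v) = g" "p \<odot> hexp ((1 - l) *\<^sub>R v) = g \<odot> hexp v"
    unfolding p_def heis_mult_assoc hexp_mult_collinear by simp_all
  then have "u p - l * (s \<bullet> v) \<le> u g" "u p + (1 - l) * (s \<bullet> v) \<le> u (g \<odot> hexp v)"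
    using s[of "(- l) *\<^sub>R v"] s[of "(1 - l) *\<^sub>R v"] by simp_all
  then have "(1 - l) * (u p - l * (s \<bullet> v)) + l * (u p + (1 - l) * (s \<bullet> v))
      \<le> (1 - l) * u g + l * u (g \<odot> hexp v)"
    using l by (intro add_mono mult_left_mono) auto
  then show "u (g \<odot> hexp (l *\<^sub>R v)) \<le> u g + l * (u (g \<odot> hexp v) - u g)"
    by (simp add: p_def algebra_simps)
qed

theorem theorem3p2:
  shows "(\<forall>u. H_convex u \<longrightarrow>
            maximal_H_monotone (H_subdiff u) \<and>
            H_cyclically_monotone (H_subdiff u) \<and>
            maximal_H_cyclically_monotone (H_subdiff u)) \<and>
         (\<forall>T. maximal_H_cyclically_monotone T \<and> sv_dom T = UNIV \<longrightarrow>
            (\<exists>u. H_convex u \<and> T = H_subdiff u))"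
proof (intro conjI allI impI)
  fix T
  assume T: "maximal_H_cyclically_monotone T \<and> sv_dom T = UNIV"
  then have dom: "T g \<noteq> {}" for g
    by (auto simp: sv_dom_def)
  obtain u where u: "\<And>g. T g \<subseteq> H_subdiff u g"
    using H_cyclically_monotone_potential[of T] T dom
    by (auto simp: maximal_H_cyclically_monotone_def)
  \<comment> \<open>\<open>H_subdiff u\<close> contains \<open>T\<close>, whose values are all
    nonempty.\<close>
  then have "H_convex u"
    using dom by (intro H_convex_if_H_subdiff_nonempty) blast
  \<comment> \<open>\<open>H_subdiff u\<close> is a cyclically monotone extension of
    \<open>T\<close>, so maximality of \<open>T\<close> forces equality.\<close>
  moreover have "T = H_subdiff u"
    using T u H_subdiff_cyclically_monotone[of u]
    unfolding maximal_H_cyclically_monotone_def by (metis ext psubsetI)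
  ultimately show "\<exists>u. H_convex u \<and> T = H_subdiff u"
    by blast
qed (auto intro: H_subdiff_maximal_H_monotone H_subdiff_cyclically_monotone
    H_subdiff_maximal_H_cyclically_monotone)

end
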